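(* For every integer $n\ge 2$, the $n$-cubion satisfies $\mathfrak Q_n\in D_{n-1}\setminus D_{n-2}$.
   Context: All graphs are finite, undirected, without loops or multiple edges, with at least one vertex. For a graph $X$ and a vertex $x$, $N_X(x)$ is the set of neighbours of $x$, identified with the subgraph of $X$ it induces, and $N_X[x]=N_X(x)\cup\{x\}$. A graph $X$ is a cone if it has a vertex $x$ (an apex) with $N_X[x]=V(X)$; the one-vertex graph is a cone. Let $D_{-1}$ be the class of cones. Inductively, for an integer $k\ge 0$: a vertex $x$ of $X$ is $k$-dismantlable if $N_X(x)$ is non-empty and the graph $N_X(x)$ belongs to $D_{k-1}$; a graph is $k$-dismantlable if it can be reduced to a single vertex by successively deleting vertices, each being $k$-dismantlable in the current graph; $D_k$ is the class of $k$-dismantlable graphs. The $n$-cubion $\mathfrak Q_n$ is the graph with vertex set $\{\alpha_{i,\epsilon} : 1\le i\le n,\ \epsilon\in\{0,1\}\}\cup\{0,1\}^n$ (a disjoint union, so $2n+2^n$ vertices) and with exactly the following edges: $\alpha_{i,\epsilon}\sim\alpha_{j,\epsilon'}$ for all $i\ne j$ and all $\epsilon,\epsilon'\in\{0,1\}$; $x\sim x'$ for all distinct $x,x'\in\{0,1\}^n$; and $\alpha_{i,\epsilon}\sim x$ for each $x=(x_1,\dots,x_n)\in\{0,1\}^n$ with $x_i=\epsilon$. *)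

theory Defs
  imports "Graph_Theory.Graph_Theory" "HOL-Library.FuncSet"
begin

text \<open>Undirected finite simple graphs are the symmetric, loop-free digraphs without parallel
  arcs of the locale \<^locale>\<open>graph\<close>. That locale admits the empty graph; the definitions
  below put only graphs with at least one vertex into the classes \<open>D k\<close>.\<close>

definition nbrs :: "('a, 'b) pre_digraph \<Rightarrow> 'a \<Rightarrow> 'a set" where
  "nbrs X x = {y. x \<rightarrow>\<^bsub>X\<^esub> y}"

definition closed_nbrs :: "('a, 'b) pre_digraph \<Rightarrow> 'a \<Rightarrow> 'a set" where
  "closed_nbrs X x = nbrs X x \<union> {x}"

definition cones :: "('a, 'b) pre_digraph set" where
  "cones = {X. graph X \<and> (\<exists>x\<in>verts X. closed_nbrs X x = verts X)}"

definition dismantlable_vertex ::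
  "('a, 'b) pre_digraph set \<Rightarrow> ('a, 'b) pre_digraph \<Rightarrow> 'a \<Rightarrow> bool" where
  "dismantlable_vertex C X x \<longleftrightarrow>
     x \<in> verts X \<and> nbrs X x \<noteq> {} \<and> X \<restriction> nbrs X x \<in> C"

inductive_set dismantlable ::
  "('a, 'b) pre_digraph set \<Rightarrow> ('a, 'b) pre_digraph set"
  for C :: "('a, 'b) pre_digraph set" where
  single: "graph X \<Longrightarrow> verts X = {x} \<Longrightarrow> X \<in> dismantlable C"
| delete: "graph X \<Longrightarrow> dismantlable_vertex C X x \<Longrightarrow>
    pre_digraph.del_vert X x \<in> dismantlable C \<Longrightarrow> X \<in> dismantlable C"

text \<open>The index of \<open>D k\<close> starts at \<open>k = -1\<close>, the one of \<open>D_shifted\<close> at \<open>0\<close>.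
  The value of \<open>D k\<close> for \<open>k < -1\<close> is irrelevant.\<close>

primrec D_shifted :: "nat \<Rightarrow> ('a, 'b) pre_digraph set" where
  "D_shifted 0 = cones"
| "D_shifted (Suc m) = dismantlable (D_shifted m)"

definition D :: "int \<Rightarrow> ('a, 'b) pre_digraph set" where
  "D k = D_shifted (nat (k + 1))"

lemma D_minus_one: "D (-1) = cones"
  by (simp add: D_def)

lemma D_nonneg:
  assumes "k \<ge> 0"
  shows "D k = dismantlable (D (k - 1))"
proof -
  have "nat (k + 1) = Suc (nat (k - 1 + 1))" using assms by simp
  then show ?thesis by (simp only: D_def D_shifted.simps)
qed

datatype cubion_vertex = Alpha nat nat | Cube "nat \<Rightarrow> nat"

text \<open>The cube \<open>{0,1}\<^sup>n\<close> is rendered as the set of extensional functions from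
  \<open>{1..n}\<close> to \<open>{0,1}\<close>.\<close>

definition cubion_verts :: "nat \<Rightarrow> cubion_vertex set" where
  "cubion_verts n =
     {Alpha i e | i e. i \<in> {1..n} \<and> e \<in> {0, 1}} \<union> Cube ` ({1..n} \<rightarrow>\<^sub>E {0, 1})"

fun cubion_adj :: "cubion_vertex \<Rightarrow> cubion_vertex \<Rightarrow> bool" where
  "cubion_adj (Alpha i e) (Alpha j e') \<longleftrightarrow> i \<noteq> j"
| "cubion_adj (Cube x) (Cube x') \<longleftrightarrow> x \<noteq> x'"
| "cubion_adj (Alpha i e) (Cube x) \<longleftrightarrow> x i = e"
| "cubion_adj (Cube x) (Alpha i e) \<longleftrightarrow> x i = e"

definition cubion :: "nat \<Rightarrow> (cubion_vertex, cubion_vertex \<times> cubion_vertex) pre_digraph" where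
  "cubion n = with_proj \<lparr> pverts = cubion_verts n,
     parcs = {(u, v). u \<in> cubion_verts n \<and> v \<in> cubion_verts n \<and> cubion_adj u v} \<rparr>"

lemma cubion_adj_sym: "cubion_adj u v \<longleftrightarrow> cubion_adj v u"
  by (cases u; cases v) auto

lemma cubion_adj_irrefl: "\<not> cubion_adj u u"
  by (cases u) auto

lemma finite_cubion_verts: "finite (cubion_verts n)"
proof -
  have "{Alpha i e | i e. i \<in> {1..n} \<and> e \<in> {0, 1}} = (\<lambda>(i, e). Alpha i e) ` ({1..n} \<times> {0, 1})"
    by auto
  then show ?thesis
    by (simp add: cubion_verts_def finite_PiE)
qed

lemma graph_cubion: "graph (cubion n)"
proof -
  let ?E = "{(u, v). u \<in> cubion_verts n \<and> v \<in> cubion_verts n \<and> cubion_adj u v}"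
  have "finite ?E"
    by (rule finite_subset[of _ "cubion_verts n \<times> cubion_verts n"])
      (auto simp: finite_cubion_verts)
  then have "pair_graph \<lparr> pverts = cubion_verts n, parcs = ?E \<rparr>"
    by unfold_locales
      (auto simp: finite_cubion_verts cubion_adj_irrefl symmetric_def sym_def cubion_adj_sym)
  then show ?thesis
    unfolding cubion_def by (rule pair_graph.pair_graphD_graph)
qed

lemma card_cubion_verts: "card (cubion_verts n) = 2 * n + 2 ^ n"
proof -
  let ?A = "(\<lambda>(i, e). Alpha i e) ` ({1..n} \<times> {0, 1})"
  let ?B = "Cube ` ({1..n} \<rightarrow>\<^sub>E {0, 1})"
  have "cubion_verts n = ?A \<union> ?B"
    by (auto simp: cubion_verts_def)
  moreover have "card (?A \<union> ?B) = card ?A + card ?B"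
    by (rule card_Un_disjoint) (auto simp: finite_PiE)
  moreover have "card ?A = 2 * n"
    by (subst card_image) (auto simp: inj_on_def card_cartesian_product)
  moreover have "card ?B = 2 ^ n"
    by (subst card_image) (auto simp: inj_on_def card_PiE numeral_2_eq_2)
  ultimately show ?thesis by simp
qed

end

theory Submission
  imports Defs
begin

text \<open>
  Both bounds go by induction on dimension, and they rest on the fact that the neighbourhood of
  \<open>\<alpha>\<^sub>i\<^sub>,\<^sub>\<epsilon>\<close> in the \<open>n\<close>-cubion is a cubion of dimension \<open>n - 1\<close>, spanned by the
  \<open>\<alpha>\<^sub>j\<^sub>,\<^sub>\<delta>\<close> with \<open>j \<noteq> i\<close> and by the facet \<open>x\<^sub>i = \<epsilon>\<close> of the cube
  (\<open>nbrs_Alpha_in_face\<close>). Iterating this leads to the subgraphs induced on \<open>face n J c\<close>, where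
  \<open>J\<close> is the set of free coordinates and \<open>c\<close> gives the fixed ones. As all graphs that occur are
  induced subgraphs of the one graph \<open>cubion n\<close>, the argument does not have to transport
  dismantlability along isomorphisms.

  Upper bound (\<open>face_in_D_shifted\<close>). By induction \<open>\<alpha>\<^sub>i\<^sub>,\<^sub>0\<close> may be deleted. Then every
  cube vertex \<open>x\<close> with \<open>x\<^sub>i = 0\<close> is dominated by its mirror image, which differs from it in
  coordinate \<open>i\<close> only, because \<open>\<alpha>\<^sub>i\<^sub>,\<^sub>0\<close> was the only neighbour of \<open>x\<close> that the
  mirror image does not see. When these are deleted too, \<open>\<alpha>\<^sub>i\<^sub>,\<^sub>1\<close> is an apex, and
  cones are dismantlable at every level.

  Lower bound (\<open>face_notin_D_shifted\<close>). A cubion of dimension \<open>1\<close> is not a cone. In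
  higher dimension it is enough that no vertex is \<open>(n - 2)\<close>-dismantlable, so that none can be
  deleted first. For \<open>\<alpha>\<^sub>i\<^sub>,\<^sub>\<epsilon>\<close> this is the induction hypothesis.
  The neighbourhood of a cube vertex is homotopically a sphere, while the clique complexes of graphs in any \<open>D k\<close> are contractible. All
  that is needed of this is an Euler characteristic: the sum of \<open>(-1)\<^bsup>|c|\<^esup>\<close> over
  all cliques \<open>c\<close>, the empty one included, vanishes on every \<open>D k\<close>
  (\<open>graph_clique_sum_D_shifted\<close>), but is \<open>1\<close> or \<open>-1\<close> for the neighbourhood of a cube vertex
  (\<open>graph_clique_sum_nbrs_Cube\<close>).
\<close>

section \<open>Alternating sums over cliques\<close>

definition cliques :: "('a \<Rightarrow> 'a \<Rightarrow> bool) \<Rightarrow> 'a set \<Rightarrow> 'a set set" where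
  "cliques R S = {c. c \<subseteq> S \<and> (\<forall>u\<in>c. \<forall>v\<in>c. u \<noteq> v \<longrightarrow> R u v)}"

text \<open>Since the empty clique is counted, this is minus the reduced Euler characteristic of the clique
  complex of \<open>R\<close> on \<open>S\<close>.\<close>

definition clique_sum :: "('a \<Rightarrow> 'a \<Rightarrow> bool) \<Rightarrow> 'a set \<Rightarrow> int" where
  "clique_sum R S = (\<Sum>c\<in>cliques R S. (-1) ^ card c)"

lemma finite_cliques: "finite S \<Longrightarrow> finite (cliques R S)"
  by (rule finite_subset[of _ "Pow S"]) (auto simp: cliques_def)

lemma clique_sum_cong:
  assumes "\<And>u v. u \<in> S \<Longrightarrow> v \<in> S \<Longrightarrow> R u v \<longleftrightarrow> R' u v"
  shows "clique_sum R S = clique_sum R' S"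
proof -
  have "cliques R S = cliques R' S"
    unfolding cliques_def using assms by blast
  then show ?thesis by (simp add: clique_sum_def)
qed

text \<open>The cliques that contain \<open>v\<close> are the cliques of its neighbourhood with \<open>v\<close> added, which
  changes their sign. This is the recursion that matches the deletion of a vertex.\<close>

lemma clique_sum_delete:
  assumes fin: "finite S" and sym: "\<And>u v. R u v \<Longrightarrow> R v u"
    and v: "v \<in> S" and N: "N = {u \<in> S - {v}. R v u}"
  shows "clique_sum R S = clique_sum R (S - {v}) - clique_sum R N"
proof -
  have split: "cliques R S = cliques R (S - {v}) \<union> insert v ` cliques R N"
  proof (intro equalityI subsetI)
    fix c assume c: "c \<in> cliques R S"
    show "c \<in> cliques R (S - {v}) \<union> insert v ` cliques R N"
    proof (cases "v \<in> c")
      case True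
      then have "c = insert v (c - {v})" by auto
      moreover have "c - {v} \<in> cliques R N"
        using c True by (auto simp: cliques_def N)
      ultimately show ?thesis by blast
    next
      case False
      then show ?thesis using c by (auto simp: cliques_def)
    qed
  next
    fix c assume "c \<in> cliques R (S - {v}) \<union> insert v ` cliques R N"
    then show "c \<in> cliques R S"
      using v sym by (fastforce simp: cliques_def N)
  qed
  have finN: "finite N" using fin by (simp add: N)
  have notin: "v \<notin> c" "finite c" if "c \<in> cliques R N" for c
    using that finN by (auto simp: cliques_def N intro: finite_subset)
  have "clique_sum R S =
      clique_sum R (S - {v}) + (\<Sum>c\<in>insert v ` cliques R N. (-1) ^ card c)"
    unfolding clique_sum_def split
    by (rule sum.union_disjoint) (use fin finN in \<open>auto simp: finite_cliques\<close>, auto simp: cliques_def)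
  also have "(\<Sum>c\<in>insert v ` cliques R N. (-1) ^ card c) =
      (\<Sum>c\<in>cliques R N. (-1) ^ card (insert v c) :: int)"
  proof (rule sum.reindex_cong[OF _ refl refl])
    show "inj_on (insert v) (cliques R N)"
      by (rule inj_onI) (metis insert_ident notin(1))
  qed
  also have "\<dots> = - clique_sum R N"
    by (simp add: clique_sum_def notin flip: sum_negf)
  finally show ?thesis by simp
qed

lemma sum_Pow_neg_one_power_card:
  assumes "finite A"
  shows "(\<Sum>B\<in>Pow A. (-1) ^ card B) = (if A = {} then 1 else 0 :: int)"
  using prod_diff_conv_sum[OF assms, of "\<lambda>_. 1::int" "\<lambda>_. 1"] assms by (auto simp: power_0_left)

text \<open>Deleting the apex leaves its neighbourhood, so the two terms of the recursion cancel.\<close>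

lemma clique_sum_cone:
  assumes "finite S" "a \<in> S" "\<And>u. u \<in> S - {a} \<Longrightarrow> R a u" and sym: "\<And>u v. R u v \<Longrightarrow> R v u"
  shows "clique_sum R S = 0"
proof -
  have "clique_sum R S = clique_sum R (S - {a}) - clique_sum R (S - {a})"
    by (rule clique_sum_delete) (use assms in blast)+
  then show ?thesis by simp
qed

text \<open>A clique of \<open>P \<union> Q\<close> is a subset \<open>A\<close> of \<open>P\<close> together with an arbitrary set of common
  neighbours of \<open>A\<close> in \<open>Q\<close>. For fixed \<open>A\<close> the signs cancel as soon as there is such a
  neighbour, and only the sets \<open>A\<close> without one contribute.\<close>

lemma clique_sum_two_cliques:
  assumes fin: "finite P" "finite Q" and disj: "P \<inter> Q = {}"
    and sym: "\<And>u v. R u v \<Longrightarrow> R v u"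
    and P: "P \<in> cliques R P" and Q: "Q \<in> cliques R Q"
  shows "clique_sum R (P \<union> Q) =
    (\<Sum>A | A \<subseteq> P \<and> \<not> (\<exists>q\<in>Q. \<forall>a\<in>A. R a q). (-1) ^ card A)"
proof -
  let ?common = "\<lambda>A. {q \<in> Q. \<forall>a\<in>A. R a q}"
  let ?join = "\<lambda>(A, B). A \<union> B"
  have eq: "cliques R (P \<union> Q) = ?join ` (SIGMA A : Pow P. Pow (?common A))"
  proof (intro equalityI subsetI)
    fix c assume c: "c \<in> cliques R (P \<union> Q)"
    then have "c = ?join (c \<inter> P, c \<inter> Q)" by (auto simp: cliques_def)
    moreover have "R u v" if "u \<in> c \<inter> P" "v \<in> c \<inter> Q" for u v
    proof -
      have "u \<noteq> v" using that disj by blast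
      then show ?thesis using c that unfolding cliques_def by blast
    qed
    then have "(c \<inter> P, c \<inter> Q) \<in> (SIGMA A : Pow P. Pow (?common A))" by blast
    ultimately show "c \<in> ?join ` (SIGMA A : Pow P. Pow (?common A))" by (rule image_eqI)
  next
    fix c assume "c \<in> ?join ` (SIGMA A : Pow P. Pow (?common A))"
    then obtain A B where c: "c = A \<union> B" and A: "A \<subseteq> P" and B: "B \<subseteq> ?common A" by auto
    have "R u v" if uv: "u \<in> c" "v \<in> c" "u \<noteq> v" for u v
    proof -
      consider "u \<in> A" "v \<in> A" | "u \<in> A" "v \<in> B" | "u \<in> B" "v \<in> A" | "u \<in> B" "v \<in> B"
        using uv c by blast
      then show ?thesis
      proof cases
        case 1
        then show ?thesis using P A \<open>u \<noteq> v\<close> unfolding cliques_def by blast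
      next
        case 2
        then show ?thesis using B by blast
      next
        case 3
        then show ?thesis using B sym by blast
      next
        case 4
        then show ?thesis using Q B \<open>u \<noteq> v\<close> unfolding cliques_def by blast
      qed
    qed
    moreover have "c \<subseteq> P \<union> Q" using c A B by blast
    ultimately show "c \<in> cliques R (P \<union> Q)" unfolding cliques_def by blast
  qed
  have inj: "inj_on ?join (SIGMA A : Pow P. Pow (?common A))"
  proof (rule inj_on_inverseI[where g = "\<lambda>c. (c \<inter> P, c \<inter> Q)"])
    fix z assume "z \<in> (SIGMA A : Pow P. Pow (?common A))"
    then obtain A B where "z = (A, B)" "A \<subseteq> P" "B \<subseteq> Q" by blast
    then show "(?join z \<inter> P, ?join z \<inter> Q) = z" using disj by auto
  qed
  have "clique_sum R (P \<union> Q) =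
      (\<Sum>(A, B)\<in>(SIGMA A : Pow P. Pow (?common A)). (-1) ^ card (A \<union> B))"
    unfolding clique_sum_def eq using inj by (subst sum.reindex) (auto simp: case_prod_unfold)
  also have "\<dots> = (\<Sum>A\<in>Pow P. \<Sum>B\<in>Pow (?common A). (-1) ^ card (A \<union> B))"
    using fin by (subst sum.Sigma) auto
  also have "\<dots> = (\<Sum>A\<in>Pow P. (-1) ^ card A * (\<Sum>B\<in>Pow (?common A). (-1) ^ card B))"
  proof (intro sum.cong refl, unfold sum_distrib_left, intro sum.cong refl)
    fix A B assume "A \<in> Pow P" "B \<in> Pow (?common A)"
    then have "card (A \<union> B) = card A + card B"
      using fin disj by (intro card_Un_disjoint) (auto intro: finite_subset)
    then show "(-1) ^ card (A \<union> B) = (-1) ^ card A * ((-1) ^ card B :: int)"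
      by (simp add: power_add)
  qed
  also have "\<dots> = (\<Sum>A\<in>Pow P. if ?common A = {} then (-1) ^ card A else 0)"
    using fin by (intro sum.cong refl) (simp add: sum_Pow_neg_one_power_card)
  also have "\<dots> = (\<Sum>A | A \<subseteq> P \<and> \<not> (\<exists>q\<in>Q. \<forall>a\<in>A. R a q). (-1) ^ card A)"
    using fin by (intro sum.mono_neutral_cong_right) auto
  finally show ?thesis .
qed

section \<open>Induced subgraphs\<close>

lemma graph_induce_subgraph:
  assumes "graph G" "S \<subseteq> verts G"
  shows "graph (G \<restriction> S)"
proof -
  interpret G: graph G by fact
  have sub: "subgraph (G \<restriction> S) G" by (rule G.subgraph_induce_subgraphI) fact
  have "sym (arcs_ends (G \<restriction> S))"
  proof (rule symI)
    fix u v assume "(u, v) \<in> arcs_ends (G \<restriction> S)"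
    then have "u \<in> S" "v \<in> S" "(u, v) \<in> arcs_ends G"
      by (auto simp: arcs_ends_conv)
    moreover from this(3) have "(v, u) \<in> arcs_ends G" by (rule G.graph_symmetric)
    ultimately show "(v, u) \<in> arcs_ends (G \<restriction> S)" by (auto simp: arcs_ends_conv)
  qed
  then show ?thesis
    using G.digraph_subgraph[OF sub]
    by (simp add: graph_def pseudo_graph_def sym_digraph_def sym_digraph_axioms_def
        symmetric_def digraph_def fin_digraph_def)
qed

lemma nbrs_induce_subgraph: "x \<in> S \<Longrightarrow> nbrs (G \<restriction> S) x = nbrs G x \<inter> S"
  by (auto simp: nbrs_def arcs_ends_conv)

lemma nbrs_subset_verts: "graph G \<Longrightarrow> nbrs G x \<subseteq> verts G"
  unfolding nbrs_def graph_def digraph_def fin_digraph_def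
  by (auto intro: wf_digraph.adj_in_verts)

lemma nbrs_sym: "graph G \<Longrightarrow> y \<in> nbrs G x \<longleftrightarrow> x \<in> nbrs G y"
  unfolding nbrs_def graph_def pseudo_graph_def
  by (auto intro: sym_digraph.graph_symmetric)

lemma nbrs_irrefl: "graph G \<Longrightarrow> x \<notin> nbrs G x"
  unfolding nbrs_def graph_def digraph_def
  by (auto dest: loopfree_digraph.adj_not_same)

lemma induce_subgraph_twice: "T \<subseteq> S \<Longrightarrow> (G \<restriction> S) \<restriction> T = G \<restriction> T"
  by (auto simp: induce_subgraph_def)

lemma del_vert_induce_subgraph: "pre_digraph.del_vert (G \<restriction> S) x = G \<restriction> (S - {x})"
  by (auto simp: induce_subgraph_def pre_digraph.del_vert_def)

lemma induce_subgraph_verts_self: "graph G \<Longrightarrow> G \<restriction> verts G = G"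
  by (auto simp: induce_subgraph_def graph_def digraph_def fin_digraph_def wf_digraph_def
      intro!: pre_digraph.equality)

section \<open>Dismantlable graphs\<close>

lemma induce_subgraph_in_cones:
  assumes G: "graph G" and S: "S \<subseteq> verts G" and a: "a \<in> S" "S - {a} \<subseteq> nbrs G a"
  shows "G \<restriction> S \<in> cones"
proof -
  have "closed_nbrs (G \<restriction> S) a = S"
    using a by (auto simp: closed_nbrs_def nbrs_induce_subgraph)
  then show ?thesis
    using a graph_induce_subgraph[OF G S] by (auto simp: cones_def)
qed

lemma dismantlable_delete_induced:
  assumes G: "graph G" and S: "S \<subseteq> verts G" and x: "x \<in> S" "nbrs G x \<inter> S \<noteq> {}"
    and nbhd: "G \<restriction> (nbrs G x \<inter> S) \<in> C"
    and rest: "G \<restriction> (S - {x}) \<in> dismantlable C"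
  shows "G \<restriction> S \<in> dismantlable C"
proof (rule dismantlable.delete[of _ _ x])
  show "graph (G \<restriction> S)" using G S by (rule graph_induce_subgraph)
  show "dismantlable_vertex C (G \<restriction> S) x"
    using x nbhd by (simp add: dismantlable_vertex_def nbrs_induce_subgraph induce_subgraph_twice)
  show "pre_digraph.del_vert (G \<restriction> S) x \<in> dismantlable C"
    using rest by (simp add: del_vert_induce_subgraph)
qed

text \<open>If \<open>a\<close> dominates \<open>x\<close>, then the neighbourhood of \<open>x\<close> is a cone with apex \<open>a\<close>.\<close>

lemma dismantlable_delete_dominated:
  assumes G: "graph G" and S: "S \<subseteq> verts G" and x: "x \<in> S" and a: "a \<in> nbrs G x \<inter> S"
    and dom: "nbrs G x \<inter> S - {a} \<subseteq> nbrs G a" and C: "cones \<subseteq> C"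
    and rest: "G \<restriction> (S - {x}) \<in> dismantlable C"
  shows "G \<restriction> S \<in> dismantlable C"
proof (rule dismantlable_delete_induced[OF G S x _ _ rest])
  show "nbrs G x \<inter> S \<noteq> {}" using a by blast
  show "G \<restriction> (nbrs G x \<inter> S) \<in> C"
    using induce_subgraph_in_cones[OF G _ a dom] S C by blast
qed

text \<open>The apex dominates every other vertex, so these can be deleted in any order.\<close>

lemma cones_subset_dismantlable: "cones \<subseteq> dismantlable cones"
proof
  fix X :: "('a, 'b) pre_digraph"
  assume "X \<in> cones"
  then obtain a where X: "graph X" and a: "a \<in> verts X" "closed_nbrs X a = verts X"
    by (auto simp: cones_def)
  have fin: "finite (verts X)"
    using X by (simp add: graph_def digraph_def fin_digraph_def fin_digraph_axioms_def)
  have "F \<subseteq> nbrs X a \<Longrightarrow> X \<restriction> insert a F \<in> dismantlable cones" if "finite F" for F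
    using that
  proof (induction F)
    case empty
    show ?case
      using a by (intro dismantlable.single[OF graph_induce_subgraph[OF X]]) auto
  next
    case (insert x F)
    have xa: "x \<noteq> a" using insert.prems nbrs_irrefl[OF X] by auto
    show ?case
    proof (rule dismantlable_delete_dominated[OF X, of _ x a])
      show "insert a (insert x F) \<subseteq> verts X"
        using a insert.prems nbrs_subset_verts[OF X] by blast
      show "a \<in> nbrs X x \<inter> insert a (insert x F)"
        using insert.prems nbrs_sym[OF X] by blast
      show "nbrs X x \<inter> insert a (insert x F) - {a} \<subseteq> nbrs X a"
        using insert.prems by blast
      have "insert a (insert x F) - {x} = insert a F" using xa insert.hyps by auto
      then show "X \<restriction> (insert a (insert x F) - {x}) \<in> dismantlable cones"
        using insert by simp
    qed auto
  qed
  from this[of "nbrs X a"] have "X \<restriction> verts X \<in> dismantlable cones"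
    using a finite_subset[OF nbrs_subset_verts[OF X] fin] by (auto simp: closed_nbrs_def)
  then show "X \<in> dismantlable cones"
    by (simp add: induce_subgraph_verts_self[OF X])
qed

lemma dismantlable_mono:
  assumes "C \<subseteq> C'"
  shows "dismantlable C \<subseteq> dismantlable C'"
proof
  fix X assume "X \<in> dismantlable C"
  then show "X \<in> dismantlable C'"
  proof induction
    case (single X x)
    then show ?case by (rule dismantlable.single)
  next
    case (delete X x)
    then show ?case
      using assms by (intro dismantlable.delete[of X _ x]) (auto simp: dismantlable_vertex_def)
  qed
qed

lemma D_shifted_subset_Suc: "D_shifted m \<subseteq> D_shifted (Suc m)"
  by (induction m) (simp_all add: cones_subset_dismantlable dismantlable_mono)

lemma cones_subset_D_shifted: "cones \<subseteq> D_shifted m"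
proof (induction m)
  case (Suc m)
  then show ?case using D_shifted_subset_Suc by (rule subset_trans)
qed simp

abbreviation graph_clique_sum :: "('a, 'b) pre_digraph \<Rightarrow> int" where
  "graph_clique_sum X \<equiv> clique_sum (\<lambda>u v. v \<in> nbrs X u) (verts X)"

lemma graph_clique_sum_induce_subgraph:
  "graph_clique_sum (G \<restriction> S) = clique_sum (\<lambda>u v. v \<in> nbrs G u) S"
  by (simp, rule clique_sum_cong) (simp add: nbrs_induce_subgraph)

lemma graph_clique_sum_del_vert:
  assumes X: "graph X" and x: "x \<in> verts X"
  shows "graph_clique_sum X =
    graph_clique_sum (pre_digraph.del_vert X x) - graph_clique_sum (X \<restriction> nbrs X x)"
proof -
  have "finite (verts X)"
    using X by (simp add: graph_def digraph_def fin_digraph_def fin_digraph_axioms_def)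
  moreover have "nbrs X x = {u \<in> verts X - {x}. u \<in> nbrs X x}"
    using nbrs_subset_verts[OF X] nbrs_irrefl[OF X] by auto
  ultimately have "graph_clique_sum X = clique_sum (\<lambda>u v. v \<in> nbrs X u) (verts X - {x})
      - clique_sum (\<lambda>u v. v \<in> nbrs X u) (nbrs X x)"
    using x nbrs_sym[OF X] by (intro clique_sum_delete) auto
  moreover have "pre_digraph.del_vert X x = X \<restriction> (verts X - {x})"
    using del_vert_induce_subgraph[of X "verts X" x] by (simp add: induce_subgraph_verts_self[OF X])
  ultimately show ?thesis by (simp only: graph_clique_sum_induce_subgraph)
qed

text \<open>The obstruction behind the lower bound. It does not depend on the level: a deletion removes a
  vertex whose neighbourhood has clique sum zero by induction on the level, so it preserves the
  clique sum, and a single vertex has clique sum \<open>1 - 1 = 0\<close>.\<close>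

lemma graph_clique_sum_D_shifted: "X \<in> D_shifted m \<Longrightarrow> graph_clique_sum X = 0"
proof (induction m arbitrary: X)
  case 0
  then obtain a where X: "graph X" and a: "a \<in> verts X" "closed_nbrs X a = verts X"
    by (auto simp: cones_def)
  show ?case
  proof (rule clique_sum_cone)
    show "finite (verts X)"
      using X by (simp add: graph_def digraph_def fin_digraph_def fin_digraph_axioms_def)
  qed (use a nbrs_sym[OF X] in \<open>auto simp: closed_nbrs_def\<close>)
next
  case (Suc m)
  from Suc.prems have "X \<in> dismantlable (D_shifted m)" by simp
  then show ?case
  proof induction
    case (single X x)
    then show ?case by (intro clique_sum_cone[of _ x]) (auto simp: nbrs_sym)
  next
    case (delete X x)
    have "graph_clique_sum (X \<restriction> nbrs X x) = 0"
      using delete.hyps Suc.IH by (simp only: dismantlable_vertex_def)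
    then show ?case
      using delete graph_clique_sum_del_vert[of X x] by (simp only: dismantlable_vertex_def)
  qed
qed

section \<open>Faces of the cubion\<close>

definition subcube :: "nat \<Rightarrow> nat set \<Rightarrow> (nat \<Rightarrow> nat) \<Rightarrow> (nat \<Rightarrow> nat) set" where
  "subcube n J c = {x \<in> {1..n} \<rightarrow>\<^sub>E {0, 1}. \<forall>i\<in>{1..n} - J. x i = c i}"

definition face :: "nat \<Rightarrow> nat set \<Rightarrow> (nat \<Rightarrow> nat) \<Rightarrow> cubion_vertex set" where
  "face n J c = {Alpha j e | j e. j \<in> J \<and> e \<in> {0, 1}} \<union> Cube ` subcube n J c"

lemma subcube_values: "x \<in> subcube n J c \<Longrightarrow> i \<in> {1..n} \<Longrightarrow> x i = 0 \<or> x i = 1"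
  by (auto simp: subcube_def PiE_iff)

lemma verts_cubion: "verts (cubion n) = cubion_verts n"
  by (simp add: cubion_def)

lemma nbrs_cubion:
  "u \<in> cubion_verts n \<Longrightarrow> nbrs (cubion n) u = {v \<in> cubion_verts n. cubion_adj u v}"
  by (auto simp: nbrs_def cubion_def)

lemma face_subset: "J \<subseteq> {1..n} \<Longrightarrow> face n J c \<subseteq> verts (cubion n)"
  by (auto simp: face_def subcube_def cubion_verts_def verts_cubion)

lemma nbrs_cubion_Int:
  assumes "S \<subseteq> verts (cubion n)" "u \<in> S"
  shows "nbrs (cubion n) u \<inter> S = {v \<in> S. cubion_adj u v}"
proof -
  have "u \<in> cubion_verts n" "S \<subseteq> cubion_verts n" using assms by (auto simp: verts_cubion)
  then show ?thesis by (auto simp: nbrs_cubion)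
qed

lemma nbrs_cubionI:
  assumes "S \<subseteq> verts (cubion n)" "u \<in> S" "v \<in> S" "cubion_adj u v"
  shows "v \<in> nbrs (cubion n) u"
proof -
  have "u \<in> cubion_verts n" "v \<in> cubion_verts n" using assms by (auto simp: verts_cubion)
  then show ?thesis using assms by (simp add: nbrs_cubion)
qed

lemma cubion_eq_face: "cubion n = cubion n \<restriction> face n {1..n} c"
proof -
  have "face n {1..n} c = verts (cubion n)"
    by (auto simp: face_def subcube_def cubion_verts_def verts_cubion)
  then show ?thesis by (simp add: induce_subgraph_verts_self graph_cubion)
qed

lemma subcube_fix_coordinate:
  assumes "i \<in> J" "J \<subseteq> {1..n}"
  shows "subcube n (J - {i}) (c(i := e)) = {x \<in> subcube n J c. x i = e}"
proof -
  have "{1..n} - (J - {i}) = insert i ({1..n} - J)" using assms by auto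
  moreover have "(\<forall>k\<in>{1..n} - J. x k = (c(i := e)) k) \<longleftrightarrow> (\<forall>k\<in>{1..n} - J. x k = c k)" for x
    using assms by (intro ball_cong) auto
  ultimately show ?thesis unfolding subcube_def by auto
qed

text \<open>The recursive structure of cubions: the neighbourhood of an \<open>\<alpha>\<close>-vertex is the face in which
  its coordinate is fixed.\<close>

lemma nbrs_Alpha_in_face:
  assumes J: "J \<subseteq> {1..n}" and i: "i \<in> J" and e: "e \<in> {0, 1}"
  shows "nbrs (cubion n) (Alpha i e) \<inter> face n J c = face n (J - {i}) (c(i := e))"
proof -
  have "Alpha i e \<in> face n J c" using i e by (auto simp: face_def)
  then have "nbrs (cubion n) (Alpha i e) \<inter> face n J c = {v \<in> face n J c. cubion_adj (Alpha i e) v}"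
    by (rule nbrs_cubion_Int[OF face_subset[OF J]])
  also have "\<dots> = face n (J - {i}) (c(i := e))"
    unfolding face_def subcube_fix_coordinate[OF i J] by auto
  finally show ?thesis .
qed

lemma subcube_flip:
  assumes "x \<in> subcube n J c" "i \<in> J" "J \<subseteq> {1..n}" "e \<in> {0, 1}"
  shows "x(i := e) \<in> subcube n J c"
  using assms by (auto simp: subcube_def PiE_iff extensional_def)

section \<open>The upper bound\<close>

text \<open>The values of \<open>c\<close> must lie in \<open>{0, 1}\<close>, as otherwise the subcube is empty; the face with no
  free coordinate is then a single cube vertex, hence a cone.\<close>

lemma face_in_D_shifted:
  assumes "finite J" "J \<subseteq> {1..n}" "c \<in> {1..n} - J \<rightarrow> {0, 1}"
  shows "cubion n \<restriction> face n J c \<in> D_shifted (card J)"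
  using assms
proof (induction J arbitrary: c)
  case empty
  let ?x = "restrict c {1..n}"
  have "x = ?x" if "x \<in> subcube n {} c" for x
    using that by (intro extensionalityI[of x "{1..n}" ?x]) (auto simp: subcube_def PiE_iff)
  moreover have "?x \<in> subcube n {} c"
    using empty by (auto simp: subcube_def Pi_iff)
  ultimately have "subcube n {} c = {?x}" by blast
  then have "face n {} c = {Cube ?x}" by (simp add: face_def)
  then show ?case
    using face_subset[of "{}" n c] induce_subgraph_in_cones[OF graph_cubion, of "{Cube ?x}" n "Cube ?x"]
    by simp
next
  case (insert i K)
  let ?C = "D_shifted (card K) :: (cubion_vertex, cubion_vertex \<times> cubion_vertex) pre_digraph set"
  define S where "S = face n (insert i K) c"
  define Z where "Z = {Cube x | x. x \<in> subcube n (insert i K) c \<and> x i = 0}"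
  \<comment> \<open>\<open>Z\<close> is what becomes dominated once \<open>Alpha i 0\<close> is gone, \<open>T\<close> the cone that remains.\<close>
  define T where "T = S - {Alpha i 0} - Z"
  have i: "i \<in> {1..n}" using insert.prems by blast
  have SV: "S \<subseteq> verts (cubion n)" unfolding S_def using insert.prems by (intro face_subset) auto
  have T: "cubion n \<restriction> T \<in> cones"
  proof (rule induce_subgraph_in_cones[OF graph_cubion])
    show TV: "T \<subseteq> verts (cubion n)" using SV by (auto simp: T_def)
    show a: "Alpha i 1 \<in> T" by (auto simp: T_def S_def Z_def face_def)
    have "v \<in> nbrs (cubion n) (Alpha i 1)" if v: "v \<in> T - {Alpha i 1}" for v
    proof -
      have "cubion_adj (Alpha i 1) v"
      proof (cases v)
        case (Alpha j e)
        then show ?thesis using v by (auto simp: T_def S_def face_def)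
      next
        case (Cube x)
        then have x: "x \<in> subcube n (insert i K) c" "x i \<noteq> 0"
          using v by (auto simp: T_def S_def Z_def face_def)
        then have "x i = 1" using subcube_values[OF x(1) i] by simp
        then show ?thesis using Cube by simp
      qed
      then show ?thesis using nbrs_cubionI[OF TV a] v by blast
    qed
    then show "T - {Alpha i 1} \<subseteq> nbrs (cubion n) (Alpha i 1)" by blast
  qed
  have ZS: "Z \<subseteq> S" by (auto simp: Z_def S_def face_def)
  have finZ: "finite Z"
    using ZS SV finite_cubion_verts[of n] by (auto simp: verts_cubion intro: finite_subset)
  \<comment> \<open>The mirror images lie in \<open>T\<close>, so they are still there whatever part \<open>F\<close> of \<open>Z\<close> is left.\<close>
  have "F \<subseteq> Z \<Longrightarrow> cubion n \<restriction> (T \<union> F) \<in> dismantlable ?C" if "finite F" for F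
    using that
  proof (induction F)
    case empty
    then show ?case using T cones_subset_D_shifted[of "Suc (card K)"] by auto
  next
    case (insert v F)
    then obtain x where v: "v = Cube x" and x: "x \<in> subcube n (insert i K) c" "x i = 0"
      by (auto simp: Z_def)
    let ?U = "T \<union> insert v F"
    let ?y = "x(i := 1)"
    have U: "?U \<subseteq> verts (cubion n)" using SV ZS insert.prems by (auto simp: T_def)
    have "?y \<in> subcube n (insert i K) c"
      using x \<open>insert i K \<subseteq> {1..n}\<close> by (intro subcube_flip) auto
    then have y: "Cube ?y \<in> ?U" by (auto simp: T_def S_def Z_def face_def)
    have vU: "v \<in> ?U" by blast
    have xy: "x \<noteq> ?y" using x by (metis fun_upd_same zero_neq_one)
    show ?case
    proof (rule dismantlable_delete_dominated[OF graph_cubion U vU, of "Cube ?y"])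
      show "Cube ?y \<in> nbrs (cubion n) v \<inter> ?U"
        unfolding nbrs_cubion_Int[OF U vU] using y v xy by simp
      have "cubion_adj (Cube ?y) w"
        if "w \<in> ?U" "cubion_adj (Cube x) w" "w \<noteq> Cube ?y" for w
      proof (cases w)
        case (Alpha j e)
        moreover have "w \<notin> Z" by (auto simp: Alpha Z_def)
        then have "w \<in> T" using that(1) v Alpha insert.prems by auto
        then have "w \<noteq> Alpha i 0" by (simp add: T_def)
        ultimately show ?thesis using that(2) x by auto
      next
        case (Cube z)
        then show ?thesis using that(3) by auto
      qed
      then show "nbrs (cubion n) v \<inter> ?U - {Cube ?y} \<subseteq> nbrs (cubion n) (Cube ?y)"
        unfolding nbrs_cubion_Int[OF U vU] using nbrs_cubionI[OF U y] v by blast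
      show "cones \<subseteq> ?C" by (rule cones_subset_D_shifted)
      have "?U - {v} = T \<union> F" using insert.hyps insert.prems by (auto simp: T_def)
      then show "cubion n \<restriction> (?U - {v}) \<in> dismantlable ?C" using insert by simp
    qed
  qed
  from this[OF finZ] have "cubion n \<restriction> (T \<union> Z) \<in> dismantlable ?C" by blast
  moreover have "T \<union> Z = S - {Alpha i 0}"
    using ZS by (auto simp: T_def Z_def)
  ultimately have rest: "cubion n \<restriction> (S - {Alpha i 0}) \<in> dismantlable ?C" by simp
  have "insert i K - {i} = K" using insert.hyps by auto
  then have nb: "nbrs (cubion n) (Alpha i 0) \<inter> S = face n K (c(i := 0))"
    using nbrs_Alpha_in_face[of "insert i K" n i 0 c] insert.prems by (simp add: S_def)
  have c0: "c(i := 0) \<in> {1..n} - K \<rightarrow> {0, 1}"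
  proof (rule Pi_I)
    fix k assume "k \<in> {1..n} - K"
    then show "(c(i := 0)) k \<in> {0, 1}"
      using funcset_mem[OF insert.prems(2), of k] by (cases "k = i") auto
  qed
  have IH: "cubion n \<restriction> face n K (c(i := 0)) \<in> ?C"
    using insert.prems(1) by (intro insert.IH[OF _ c0]) blast
  have ne: "face n K (c(i := 0)) \<noteq> {}"
  proof -
    have "restrict (\<lambda>j. if j \<in> K then 0 else (c(i := 0)) j) {1..n} \<in> subcube n K (c(i := 0))"
      using c0 by (auto simp: subcube_def Pi_iff simp del: fun_upd_apply)
    then show ?thesis by (auto simp: face_def)
  qed
  have "cubion n \<restriction> S \<in> dismantlable ?C"
  proof (rule dismantlable_delete_induced[OF graph_cubion SV _ _ _ rest])
    show "Alpha i 0 \<in> S" by (auto simp: S_def face_def)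
  qed (use nb IH ne in simp_all)
  then show ?case using insert.hyps by (simp add: S_def)
qed

section \<open>The lower bound\<close>

text \<open>The neighbourhood of \<open>x\<close> consists of the clique of all \<open>\<alpha>\<close>-vertices compatible with \<open>x\<close> and
  the clique of the other vertices of the subcube. If some coordinate is not prescribed by a set
  \<open>A\<close> of \<open>\<alpha>\<close>-vertices, then flipping it in \<open>x\<close> gives a common neighbour of \<open>A\<close>; if all are
  prescribed, only \<open>x\<close> itself would be one. Hence just one term survives in
  \<open>clique_sum_two_cliques\<close>. (After deletion of dominated vertices this neighbourhood is the
  cross-polytope spanned by the \<open>\<alpha>\<close>-vertices and the vertices adjacent to \<open>x\<close> in the cube.)\<close>

lemma graph_clique_sum_nbrs_Cube:
  assumes J: "J \<subseteq> {1..n}" and x: "x \<in> subcube n J c"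
  shows "graph_clique_sum (cubion n \<restriction> (nbrs (cubion n) (Cube x) \<inter> face n J c)) = (-1) ^ card J"
proof -
  let ?P = "(\<lambda>j. Alpha j (x j)) ` J"
  let ?Q = "Cube ` (subcube n J c - {x})"
  let ?N = "nbrs (cubion n) (Cube x) \<inter> face n J c"
  have x01: "x j \<in> {0, 1}" if "j \<in> J" for j
    using subcube_values[OF x, of j] that J by auto
  have N: "?N = ?P \<union> ?Q"
  proof -
    have "Cube x \<in> face n J c" using x by (auto simp: face_def)
    then show ?thesis
      using nbrs_cubion_Int[OF face_subset[OF J]] x01 by (auto simp: face_def)
  qed
  have finP: "finite ?P" using J by (auto intro: finite_subset)
  have finQ: "finite ?Q"
    by (rule finite_subset[OF _ finite_cubion_verts[of n]])
      (auto simp: subcube_def cubion_verts_def)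
  have sub: "?N \<subseteq> cubion_verts n" using face_subset[OF J] by (auto simp: verts_cubion)
  have "graph_clique_sum (cubion n \<restriction> ?N) = clique_sum cubion_adj (?P \<union> ?Q)"
    unfolding graph_clique_sum_induce_subgraph N[symmetric]
  proof (rule clique_sum_cong)
    fix u v assume "u \<in> ?N" "v \<in> ?N"
    then have "u \<in> cubion_verts n" "v \<in> cubion_verts n" using sub by blast+
    then show "v \<in> nbrs (cubion n) u \<longleftrightarrow> cubion_adj u v" by (simp add: nbrs_cubion)
  qed
  also have "\<dots> = (\<Sum>A | A \<subseteq> ?P \<and> \<not> (\<exists>q\<in>?Q. \<forall>a\<in>A. cubion_adj a q). (-1) ^ card A)"
    by (rule clique_sum_two_cliques)
      (use finP finQ cubion_adj_sym in \<open>auto simp: cliques_def\<close>)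
  also have "{A. A \<subseteq> ?P \<and> \<not> (\<exists>q\<in>?Q. \<forall>a\<in>A. cubion_adj a q)} = {?P}"
  proof (intro equalityI subsetI)
    fix A assume A: "A \<in> {A. A \<subseteq> ?P \<and> \<not> (\<exists>q\<in>?Q. \<forall>a\<in>A. cubion_adj a q)}"
    have "Alpha j (x j) \<in> A" if j: "j \<in> J" for j
    proof (rule ccontr)
      assume notin: "Alpha j (x j) \<notin> A"
      let ?y = "x(j := 1 - x j)"
      have "?y \<in> subcube n J c" using x j J by (intro subcube_flip) auto
      moreover have "?y \<noteq> x" using x01[OF j]
        by (metis fun_upd_same diff_zero diff_self_eq_0 insertE singletonD zero_neq_one)
      ultimately have "Cube ?y \<in> ?Q" by blast
      moreover have "\<forall>a\<in>A. cubion_adj a (Cube ?y)" using A notin by auto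
      ultimately show False using A by blast
    qed
    then show "A \<in> {?P}" using A by blast
  next
    fix A assume "A \<in> {?P}"
    moreover have "\<not> (\<forall>a\<in>?P. cubion_adj a q)" if "q \<in> ?Q" for q
    proof
      assume all: "\<forall>a\<in>?P. cubion_adj a q"
      from that obtain y where y: "q = Cube y" "y \<in> subcube n J c" "y \<noteq> x" by blast
      have "y i = x i" for i
        using all y x
        by (cases "i \<in> J"; cases "i \<in> {1..n}") (auto simp: subcube_def PiE_iff extensional_def)
      then show False using y by blast
    qed
    ultimately show "A \<in> {A. A \<subseteq> ?P \<and> \<not> (\<exists>q\<in>?Q. \<forall>a\<in>A. cubion_adj a q)}" by blast
  qed
  also have "(\<Sum>A\<in>{?P}. (-1) ^ card A) = ((-1) ^ card J :: int)"
    by (simp add: card_image inj_on_def)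
  finally show ?thesis .
qed

text \<open>\<open>\<alpha>\<^sub>i\<^sub>,\<^sub>0\<close> and \<open>\<alpha>\<^sub>i\<^sub>,\<^sub>1\<close> are not adjacent to each other, and every cube vertex
  misses one of them.\<close>

lemma face_notin_cones:
  assumes J: "J \<subseteq> {1..n}" and j: "j \<in> J"
  shows "cubion n \<restriction> face n J c \<notin> cones"
proof
  let ?S = "face n J c"
  assume "cubion n \<restriction> ?S \<in> cones"
  then obtain a where a: "a \<in> ?S" and cl: "closed_nbrs (cubion n \<restriction> ?S) a = ?S"
    by (auto simp: cones_def)
  then have adj: "cubion_adj a v" if "v \<in> ?S" "v \<noteq> a" for v
    using that nbrs_cubion_Int[OF face_subset[OF J] a]
    by (auto simp: closed_nbrs_def nbrs_induce_subgraph)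
  show False
  proof (cases a)
    case (Alpha i e)
    with a have "i \<in> J" "e \<in> {0, 1}" by (auto simp: face_def)
    then show False using adj[of "Alpha i (1 - e)"] Alpha by (auto simp: face_def)
  next
    case (Cube x)
    with a have x: "x \<in> subcube n J c" by (auto simp: face_def)
    have "x j = 0 \<or> x j = 1" using subcube_values[OF x, of j] j J by auto
    then show False using adj[of "Alpha j (1 - x j)"] Cube j by (auto simp: face_def)
  qed
qed

text \<open>A face of positive dimension has more than one vertex, so a dismantling has a first step. Deleting an \<open>\<alpha>\<close>-vertex
  there would put a face of one dimension less into the class one level below; deleting a cube
  vertex is impossible at any level, because of the clique sum.\<close>

lemma face_notin_D_shifted:
  assumes "J \<subseteq> {1..n}" "card J = Suc m"
  shows "cubion n \<restriction> face n J c \<notin> D_shifted m"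
  using assms
proof (induction m arbitrary: J c)
  case 0
  then obtain j where "j \<in> J" by fastforce
  with 0 show ?case using face_notin_cones by simp
next
  case (Suc m)
  let ?S = "face n J c"
  show ?case
  proof
    assume "cubion n \<restriction> ?S \<in> D_shifted (Suc m)"
    then have "cubion n \<restriction> ?S \<in> dismantlable (D_shifted m)" by simp
    then show False
    proof cases
      case (single x)
      obtain j where "j \<in> J" using Suc.prems by fastforce
      then have "Alpha j 0 \<in> ?S" "Alpha j 1 \<in> ?S" by (auto simp: face_def)
      then show False using single by auto
    next
      case (delete v)
      then have v: "v \<in> ?S" and nb: "cubion n \<restriction> (nbrs (cubion n) v \<inter> ?S) \<in> D_shifted m"
        by (auto simp: dismantlable_vertex_def nbrs_induce_subgraph induce_subgraph_twice)
      show False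
      proof (cases v)
        case (Alpha i e)
        with v have i: "i \<in> J" "e \<in> {0, 1}" by (auto simp: face_def)
        then have "cubion n \<restriction> face n (J - {i}) (c(i := e)) \<in> D_shifted m"
          using nb Alpha nbrs_Alpha_in_face Suc.prems by simp
        moreover have "card (J - {i}) = Suc m" using i Suc.prems by simp
        ultimately show False using Suc.IH[of "J - {i}"] Suc.prems by blast
      next
        case (Cube x)
        with v have "x \<in> subcube n J c" by (auto simp: face_def)
        from graph_clique_sum_nbrs_Cube[OF Suc.prems(1) this] show False
          using graph_clique_sum_D_shifted[OF nb] Cube by simp
      qed
    qed
  qed
qed

theorem proposition9:
  fixes n :: nat
  assumes "n \<ge> 2"
  shows "cubion n \<in> D (int n - 1) - D (int n - 2)"
proof -
  define c :: "nat \<Rightarrow> nat" where "c = (\<lambda>_. 0)"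
  obtain m where m: "n = Suc m" using assms by (cases n) auto
  have "cubion n \<in> D_shifted n"
    using face_in_D_shifted[of "{1..n}" n c] cubion_eq_face[of n c] by simp
  moreover have "cubion n \<notin> D_shifted m"
    using face_notin_D_shifted[of "{1..n}" n m c] cubion_eq_face[of n c] m by simp
  moreover have "nat (int n - 1 + 1) = n" "nat (int n - 2 + 1) = m" using m by simp_all
  ultimately show ?thesis by (simp add: D_def)
qed

end
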